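(* The radical-annihilator monoid of a commutative local zero-dimensional ring $R$ is a contraction of one of the following three types of monoids: (a) $R$ is a field, with relations $r=a^2=1$; (b) the monoid with relations $rar=rara$ and $r=a^2r=ra^2$, in which case the $k$-number of $R$ is at most $5$; (c) the monoid with relations $ar=ara$ and $a^2r=ra^2r$, in which case the $k$-number of $R$ is at most $6$. The first monoid has $K$-number (number of elements) $2$, and the last two have $K$-number $9$.
   Context: Rings have an identity; zero-dimensional refers to Krull dimension, so a commutative local zero-dimensional ring has exactly one prime ideal. For a commutative ring $R$ and an ideal $I$: $r(I)$ is the intersection of the prime ideals containing $I$ (with $r(R)=R$), and $a(I)=\{x\in R\mid xI=\{0\}\}$. Both are maps from the set of ideals of $R$ to itself; products denote composition, e.g. $rar(I)=r(a(r(I)))$, and $1$ is the identity map. The radical-annihilator monoid of $R$ is the monoid of maps generated by $r$ and $a$ under composition. In every such monoid the relations $r^2=r$ and $a^3=a$ hold; the monoid "with relations" listed in each type is the monoid generated by symbols $r,a$ subject to $r^2=r$, $a^3=a$ and the listed relations. A contraction of such a monoid is a quotient of it (a homomorphic image sending generators to the corresponding generators), so the radical-annihilator monoid of $R$ is a contraction of a given type iff it satisfies the listed relations. The $k$-number of an ideal $I$ is the number of distinct ideals $w(I)$ with $w$ in the radical-annihilator monoid; the $k$-number of $R$ is the maximum of the $k$-numbers of its ideals ($\infty$ if they are unbounded). The $K$-number is the cardinality of the monoid. *)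

theory Defs
  imports "HOL-Algebra.Algebra" "HOL-Library.Extended_Nat"
begin

section \<open>Local and zero-dimensional rings\<close>

definition local_ring :: "('a, 'm) ring_scheme \<Rightarrow> bool" where
  "local_ring R \<longleftrightarrow> ring R \<and> (\<exists>!M. maximalideal M R)"

text \<open>
  The supremum of the lengths of strict chains of prime ideals.  The zero ring, which has no
  prime ideals, gets the value 0; it is not local.
\<close>

definition krull_dim :: "('a, 'm) ring_scheme \<Rightarrow> enat" where
  "krull_dim R =
     Sup {enat n | n. \<exists>P :: nat \<Rightarrow> 'a set.
            (\<forall>i\<le>n. primeideal (P i) R) \<and> (\<forall>i<n. P i \<subset> P (Suc i))}"


section \<open>The radical-annihilator monoid of a ring\<close>

definition ideals :: "('a, 'm) ring_scheme \<Rightarrow> 'a set set" where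
  "ideals R = {I. ideal I R}"

text \<open>
  The intersection with \<^term>\<open>carrier R\<close> gives the value \<^term>\<open>carrier R\<close> when no prime ideal
  contains \<^term>\<open>I\<close>, in particular for \<^term>\<open>I = carrier R\<close>.
\<close>

definition radical :: "('a, 'm) ring_scheme \<Rightarrow> 'a set \<Rightarrow> 'a set" where
  "radical R I = carrier R \<inter> \<Inter>{P. primeideal P R \<and> I \<subseteq> P}"

definition annihilator :: "('a, 'm) ring_scheme \<Rightarrow> 'a set \<Rightarrow> 'a set" where
  "annihilator R I = {x \<in> carrier R. \<forall>y\<in>I. x \<otimes>\<^bsub>R\<^esub> y = \<zero>\<^bsub>R\<^esub>}"

datatype ra_gen = Rad | Ann

text \<open>
  The two generating maps are made extensional on the set of ideals, as in \<^const>\<open>BijGroup\<close>, so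
  that two words give the same element exactly if they agree on every ideal.
\<close>

primrec ra_map :: "('a, 'm) ring_scheme \<Rightarrow> ra_gen \<Rightarrow> 'a set \<Rightarrow> 'a set" where
  "ra_map R Rad = (\<lambda>I \<in> ideals R. radical R I)"
| "ra_map R Ann = (\<lambda>I \<in> ideals R. annihilator R I)"

inductive_set ra_maps :: "('a, 'm) ring_scheme \<Rightarrow> ('a set \<Rightarrow> 'a set) set"
  for R :: "('a, 'm) ring_scheme" where
  one: "(\<lambda>I \<in> ideals R. I) \<in> ra_maps R"
| gen: "ra_map R x \<in> ra_maps R"
| comp: "f \<in> ra_maps R \<Longrightarrow> g \<in> ra_maps R \<Longrightarrow> compose (ideals R) f g \<in> ra_maps R"

definition ra_monoid :: "('a, 'm) ring_scheme \<Rightarrow> ('a set \<Rightarrow> 'a set) monoid" where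
  "ra_monoid R =
     \<lparr>carrier = ra_maps R,
      monoid.mult = compose (ideals R),
      one = (\<lambda>I \<in> ideals R. I)\<rparr>"


section \<open>The numbers k and K\<close>

text \<open>\<^const>\<open>card\<close> is 0 on infinite sets.\<close>

definition ecard :: "'a set \<Rightarrow> enat" where
  "ecard A = (if finite A then enat (card A) else \<infinity>)"

definition ideal_k_number :: "('a, 'm) ring_scheme \<Rightarrow> 'a set \<Rightarrow> enat" where
  "ideal_k_number R I = ecard {w I | w. w \<in> carrier (ra_monoid R)}"

definition ring_k_number :: "('a, 'm) ring_scheme \<Rightarrow> enat" where
  "ring_k_number R = (SUP I \<in> ideals R. ideal_k_number R I)"

definition K_number :: "('a, 'm) monoid_scheme \<Rightarrow> enat" where
  "K_number M = ecard (carrier M)"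


section \<open>Monoids given by generators and relations\<close>

inductive word_cong :: "('g list \<times> 'g list) set \<Rightarrow> 'g list \<Rightarrow> 'g list \<Rightarrow> bool"
  for E :: "('g list \<times> 'g list) set" where
  rel: "(u, v) \<in> E \<Longrightarrow> word_cong E u v"
| refl: "word_cong E u u"
| sym: "word_cong E u v \<Longrightarrow> word_cong E v u"
| trans: "word_cong E u v \<Longrightarrow> word_cong E v w \<Longrightarrow> word_cong E u w"
| append: "word_cong E u v \<Longrightarrow> word_cong E u' v' \<Longrightarrow> word_cong E (u @ u') (v @ v')"

definition word_class :: "('g list \<times> 'g list) set \<Rightarrow> 'g list \<Rightarrow> 'g list set" where
  "word_class E u = {v. word_cong E u v}"

definition presented_monoid :: "('g list \<times> 'g list) set \<Rightarrow> 'g list set monoid" where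
  "presented_monoid E =
     \<lparr>carrier = range (word_class E),
      monoid.mult = (\<lambda>A B. \<Union>u\<in>A. \<Union>v\<in>B. word_class E (u @ v)),
      one = word_class E []\<rparr>"

text \<open>
  The monoid \<^term>\<open>N\<close> with generators \<^term>\<open>d g\<close> is a homomorphic image of the monoid \<^term>\<open>M\<close> with
  generators \<^term>\<open>c g\<close>, corresponding generators being mapped to each other.  Since \<^const>\<open>hom\<close>
  does not require it, preservation of the identity is stated separately.
\<close>

definition contraction ::
    "('b, 'n) monoid_scheme \<Rightarrow> ('g \<Rightarrow> 'b) \<Rightarrow> ('a, 'm) monoid_scheme \<Rightarrow> ('g \<Rightarrow> 'a) \<Rightarrow> bool" where
  "contraction N d M c \<longleftrightarrow>
     (\<exists>h \<in> hom M N. h ` carrier M = carrier N \<and> h \<one>\<^bsub>M\<^esub> = \<one>\<^bsub>N\<^esub> \<and> (\<forall>g. h (c g) = d g))"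

definition ra_contraction ::
    "('a, 'm) ring_scheme \<Rightarrow> (ra_gen list \<times> ra_gen list) set \<Rightarrow> bool" where
  "ra_contraction R E \<longleftrightarrow>
     contraction (ra_monoid R) (ra_map R) (presented_monoid E) (\<lambda>g. word_class E [g])"

definition basic_rels :: "(ra_gen list \<times> ra_gen list) set" where
  "basic_rels = {([Rad, Rad], [Rad]), ([Ann, Ann, Ann], [Ann])}"

definition rels_a :: "(ra_gen list \<times> ra_gen list) set" where
  "rels_a = basic_rels \<union> {([Rad], [Ann, Ann]), ([Ann, Ann], [])}"

definition rels_b :: "(ra_gen list \<times> ra_gen list) set" where
  "rels_b = basic_rels \<union>
     {([Rad, Ann, Rad], [Rad, Ann, Rad, Ann]),
      ([Rad], [Ann, Ann, Rad]),
      ([Ann, Ann, Rad], [Rad, Ann, Ann])}"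

definition rels_c :: "(ra_gen list \<times> ra_gen list) set" where
  "rels_c = basic_rels \<union>
     {([Ann, Rad], [Ann, Rad, Ann]),
      ([Ann, Ann, Rad], [Rad, Ann, Ann, Rad])}"

end

theory Submission
  imports Defs
begin

text \<open>
  The maximal ideal \<open>M\<close> is the only prime ideal, so the radical sends every proper ideal to \<open>M\<close> and
  the whole ring to itself.  The ring is a field if \<open>M = 0\<close>; otherwise the relations of
  type (c) hold if the annihilator of \<open>M\<close> is zero, and those of type (b) if it is not.
  In both cases, the orbit of an ideal \<open>I\<close> lies in the set of \<open>I\<close>, \<open>a(I)\<close>, \<open>a(a(I))\<close> and
  the orbit of \<open>M\<close>.  The orders of the presented monoids come from complete sets
  of normal forms.
\<close>

section \<open>Normal forms in presented monoids\<close>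

lemma word_class_eq_iff: "word_class E u = word_class E v \<longleftrightarrow> word_cong E u v"
  unfolding word_class_def by (auto intro: word_cong.refl word_cong.sym word_cong.trans)

lemma word_class_mult:
  "word_class E u \<otimes>\<^bsub>presented_monoid E\<^esub> word_class E v = word_class E (u @ v)"
proof -
  have *: "word_class E (u' @ v') = word_class E (u @ v)"
    if "u' \<in> word_class E u" "v' \<in> word_class E v" for u' v'
    unfolding word_class_eq_iff
    using that by (intro word_cong.sym[OF word_cong.append]) (simp_all add: word_class_def)
  have "word_class E u \<otimes>\<^bsub>presented_monoid E\<^esub> word_class E v =
      (\<Union>u'\<in>word_class E u. \<Union>v'\<in>word_class E v. word_class E (u @ v))"
    unfolding presented_monoid_def monoid.simps by (intro SUP_cong *) simp_all
  also have "\<dots> = word_class E (u @ v)"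
    using word_cong.refl[of E u] word_cong.refl[of E v] unfolding word_class_def by blast
  finally show ?thesis .
qed

text \<open>A word acts on \<open>N\<close> as a composite of the maps \<open>s g\<close>; closure
  keeps intermediate values in \<open>N\<close>, the only place where the relations are
  assumed.\<close>

lemma word_cong_foldr:
  assumes "word_cong E u v"
    and closed: "\<And>g w. w \<in> N \<Longrightarrow> s g w \<in> N"
    and rels: "\<And>u v w. (u, v) \<in> E \<Longrightarrow> w \<in> N \<Longrightarrow> foldr s u w = foldr s v w"
    and "w \<in> N"
  shows "foldr s u w = foldr s v w"
  using assms(1,4)
proof (induction arbitrary: w)
  case (append u v u' v')
  have "foldr s x w \<in> N" for x
    by (induction x) (use closed append.prems in auto)
  then show ?case
    using append by simp
qed (use rels in auto)

text \<open>The set \<open>N\<close> is a transversal of the classes, by van der Waerden's trick: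
  normalising letter by letter moves a word into \<open>N\<close> within its class, and congruent
  words act alike on \<open>[]\<close>, which a word of \<open>N\<close> sends to itself.\<close>

lemma K_number_presented_monoid:
  assumes "[] \<in> N"
    and closed: "\<And>g w. w \<in> N \<Longrightarrow> s g w \<in> N"
    and cong: "\<And>g w. w \<in> N \<Longrightarrow> word_cong E (g # w) (s g w)"
    and rels: "\<And>u v w. (u, v) \<in> E \<Longrightarrow> w \<in> N \<Longrightarrow> foldr s u w = foldr s v w"
    and normal: "\<And>w. w \<in> N \<Longrightarrow> foldr s w [] = w"
  shows "K_number (presented_monoid E) = ecard N"
proof -
  have reduce: "foldr s u [] \<in> N \<and> word_cong E u (foldr s u [])" for u
  proof (induction u)
    case (Cons g u)
    then have "word_cong E ([g] @ u) ([g] @ foldr s u [])"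
      by (blast intro: word_cong.append word_cong.refl)
    then show ?case
      using Cons closed cong by (auto intro: word_cong.trans)
  qed (use assms(1) in \<open>auto intro: word_cong.refl\<close>)
  have "word_class E ` N = range (word_class E)"
    using reduce word_class_eq_iff by blast
  moreover have "inj_on (word_class E) N"
  proof (rule inj_onI)
    fix u v assume "u \<in> N" "v \<in> N" "word_class E u = word_class E v"
    then have "foldr s u [] = foldr s v []"
      unfolding word_class_eq_iff by (intro word_cong_foldr[OF _ closed rels assms(1)])
    then show "u = v"
      using normal \<open>u \<in> N\<close> \<open>v \<in> N\<close> by simp
  qed
  ultimately have "bij_betw (word_class E) N (range (word_class E))"
    by (simp add: bij_betw_def)
  then show ?thesis
    by (simp add: K_number_def ecard_def presented_monoid_def bij_betw_finite bij_betw_same_card)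
qed

text \<open>
  The rules list the one-letter extensions of normal forms that are not normal, with their
  normal forms.
\<close>

definition rewrite_step :: "('g list \<times> 'g list) list \<Rightarrow> 'g \<Rightarrow> 'g list \<Rightarrow> 'g list" where
  "rewrite_step rules g w = (case map_of rules (g # w) of None \<Rightarrow> g # w | Some v \<Rightarrow> v)"

lemma K_number_rewrite:
  assumes "[] \<in> N"
    and "\<forall>w\<in>N. \<forall>g. rewrite_step rules g w \<in> N"
    and "\<forall>(u, v)\<in>set rules. word_cong E u v"
    and "\<forall>(u, v)\<in>E. \<forall>w\<in>N. foldr (rewrite_step rules) u w = foldr (rewrite_step rules) v w"
    and "\<forall>w\<in>N. foldr (rewrite_step rules) w [] = w"
  shows "K_number (presented_monoid E) = ecard N"
proof (rule K_number_presented_monoid[where s = "rewrite_step rules"])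
  show "word_cong E (g # w) (rewrite_step rules g w)" for g w
    using assms(3) by (auto simp: rewrite_step_def word_cong.refl split: option.split dest: map_of_SomeD)
qed (use assms in auto)

lemma word_cong_rewrite:
  assumes "(u, v) \<in> E \<or> (v, u) \<in> E" and "word_cong E (x @ v @ y) w"
  shows "word_cong E (x @ u @ y) w"
proof -
  have "word_cong E u v"
    using assms(1) by (auto intro: word_cong.rel word_cong.sym)
  then have "word_cong E (x @ u @ y) (x @ v @ y)"
    by (intro word_cong.append word_cong.refl)
  then show ?thesis
    using assms(2) by (rule word_cong.trans)
qed

section \<open>Orders of the three presented monoids\<close>

lemma all_ra_gen: "(\<forall>g. P g) \<longleftrightarrow> P Rad \<and> P Ann"
  by (metis ra_gen.exhaust)

lemma K_number_a: "K_number (presented_monoid rels_a) = 2"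
proof -
  let ?N = "{[], [Ann]}"
  let ?rules = "[([Rad], []), ([Rad, Ann], [Ann]), ([Ann, Ann], [])]"
  note rw = word_cong_rewrite[where E = rels_a]
  have aa: "word_cong rels_a [Ann, Ann] []"
    by (rule word_cong.rel) (simp add: rels_a_def)
  have r: "word_cong rels_a [Rad] []"
    using rw[of "[Rad]" "[Ann, Ann]" "[]" "[]"] aa by (simp add: rels_a_def)
  have ra: "word_cong rels_a [Rad, Ann] [Ann]"
    using word_cong.append[OF r word_cong.refl[of _ "[Ann]"]] by simp
  have "K_number (presented_monoid rels_a) = ecard ?N"
    by (rule K_number_rewrite[where rules = ?rules])
       (use aa r ra in \<open>simp_all add: all_ra_gen rewrite_step_def,
         simp add: rels_a_def basic_rels_def rewrite_step_def\<close>)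
  then show ?thesis
    by (simp add: ecard_def numeral_eq_enat)
qed

text \<open>Both sides of \<open>r\<close> absorb \<open>a^2\<close>, and \<open>rar\<close> absorbs
  \<open>a\<close> and \<open>r\<close> on its right. So a word with \<open>r\<close> reduces to
  \<open>r\<close>, \<open>ra\<close> or \<open>rar\<close>, possibly after one \<open>a\<close>;
  with \<open>1\<close>, \<open>a\<close>, \<open>a^2\<close> this gives nine.\<close>

lemma K_number_b: "K_number (presented_monoid rels_b) = 9"
proof -
  let ?a = Ann and ?r = Rad
  let ?N = "{[], [?a], [?a,?a], [?r], [?a,?r], [?r,?a], [?a,?r,?a], [?r,?a,?r], [?a,?r,?a,?r]}"
  let ?rules = "[([?a,?a,?a], [?a]), ([?r,?r], [?r]), ([?a,?a,?r], [?r]), ([?r,?a,?a], [?r]),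
    ([?r,?r,?a], [?r,?a]), ([?a,?a,?r,?a], [?r,?a]), ([?r,?a,?r,?a], [?r,?a,?r]),
    ([?r,?r,?a,?r], [?r,?a,?r]), ([?a,?a,?r,?a,?r], [?r,?a,?r]),
    ([?r,?a,?r,?a,?r], [?r,?a,?r])]"
  note rw = word_cong_rewrite[where E = rels_b]
  have base: "word_cong rels_b [?a,?a,?a] [?a]" "word_cong rels_b [?r,?r] [?r]"
    "word_cong rels_b [?a,?a,?r] [?r]" "word_cong rels_b [?r,?a,?r,?a] [?r,?a,?r]"
    by (auto simp: rels_b_def basic_rels_def intro: word_cong.rel word_cong.sym)
  have raa: "word_cong rels_b [?r,?a,?a] [?r]"
    using rw[of "[?r,?a,?a]" "[?a,?a,?r]" "[]" "[]"] base(3) by (simp add: rels_b_def)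
  note right = word_cong.append[OF _ word_cong.refl]
  have ext: "word_cong rels_b [?r,?r,?a] [?r,?a]" "word_cong rels_b [?a,?a,?r,?a] [?r,?a]"
    "word_cong rels_b [?r,?r,?a,?r] [?r,?a,?r]" "word_cong rels_b [?a,?a,?r,?a,?r] [?r,?a,?r]"
    using right[OF base(2), of "[?a]"] right[OF base(3), of "[?a]"]
      right[OF base(2), of "[?a,?r]"] right[OF base(3), of "[?a,?r]"] by simp_all
  have "word_cong rels_b [?r,?a,?r,?r] [?r,?a,?r]"
    using word_cong.append[OF word_cong.refl[of _ "[?r,?a]"] base(2)] by simp
  then have "word_cong rels_b [?r,?a,?r,?a,?r] [?r,?a,?r]"
    using right[OF base(4), of "[?r]"] by (auto intro: word_cong.trans)
  then have "K_number (presented_monoid rels_b) = ecard ?N"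
    by (intro K_number_rewrite[where rules = ?rules])
       (use base raa ext in \<open>simp_all add: all_ra_gen rewrite_step_def,
         simp add: rels_b_def basic_rels_def rewrite_step_def\<close>)
  then show ?thesis
    by (simp add: ecard_def numeral_eq_enat)
qed

text \<open>The factor \<open>ar\<close> absorbs every letter on its right. So a word reduces to
  \<open>a^i\<close> with \<open>i \<le> 2\<close>, possibly after an \<open>r\<close>, or to such a
  word with \<open>i \<ge> 1\<close> before a last \<open>r\<close>. Of these ten words,
  \<open>raar\<close> and \<open>aar\<close> coincide.\<close>

lemma K_number_c: "K_number (presented_monoid rels_c) = 9"
proof -
  let ?a = Ann and ?r = Rad
  let ?N = "{[], [?a], [?a,?a], [?r], [?r,?a], [?r,?a,?a], [?a,?r], [?a,?a,?r], [?r,?a,?r]}"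
  let ?rules = "[([?a,?a,?a], [?a]), ([?r,?r], [?r]), ([?r,?r,?a], [?r,?a]),
    ([?r,?r,?a,?a], [?r,?a,?a]), ([?a,?r,?a], [?a,?r]), ([?a,?r,?a,?a], [?a,?r]),
    ([?a,?a,?a,?r], [?a,?r]), ([?r,?a,?a,?r], [?a,?a,?r]), ([?r,?r,?a,?r], [?r,?a,?r]),
    ([?a,?r,?a,?r], [?a,?r])]"
  have base: "word_cong rels_c [?a,?a,?a] [?a]" "word_cong rels_c [?r,?r] [?r]"
    "word_cong rels_c [?a,?r,?a] [?a,?r]" "word_cong rels_c [?r,?a,?a,?r] [?a,?a,?r]"
    by (auto simp: rels_c_def basic_rels_def intro: word_cong.rel word_cong.sym)
  note right = word_cong.append[OF _ word_cong.refl]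
  have ext: "word_cong rels_c [?r,?r,?a] [?r,?a]" "word_cong rels_c [?r,?r,?a,?a] [?r,?a,?a]"
    "word_cong rels_c [?a,?a,?a,?r] [?a,?r]" "word_cong rels_c [?r,?r,?a,?r] [?r,?a,?r]"
    using right[OF base(2), of "[?a]"] right[OF base(2), of "[?a,?a]"]
      right[OF base(1), of "[?r]"] right[OF base(2), of "[?a,?r]"] by simp_all
  have araa: "word_cong rels_c [?a,?r,?a,?a] [?a,?r]"
    using right[OF base(3), of "[?a]"] base(3) by (auto intro: word_cong.trans)
  have "word_cong rels_c [?a,?r,?r] [?a,?r]"
    using word_cong.append[OF word_cong.refl[of _ "[?a]"] base(2)] by simp
  then have "word_cong rels_c [?a,?r,?a,?r] [?a,?r]"
    using right[OF base(3), of "[?r]"] by (auto intro: word_cong.trans)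
  then have "K_number (presented_monoid rels_c) = ecard ?N"
    by (intro K_number_rewrite[where rules = ?rules])
       (use base ext araa in \<open>simp_all add: all_ra_gen rewrite_step_def,
         simp add: rels_c_def basic_rels_def rewrite_step_def\<close>)
  then show ?thesis
    by (simp add: ecard_def numeral_eq_enat)
qed

section \<open>Radicals and annihilators in commutative rings\<close>

context cring
begin

lemma ideal_annihilator:
  assumes "ideal I R"
  shows "ideal (annihilator R I) R"
proof (rule idealI)
  have I: "I \<subseteq> carrier R"
    using ideal.Icarr[OF assms] by blast
  show "subgroup (annihilator R I) (add_monoid R)"
    using I by unfold_locales
      (auto simp: annihilator_def l_distr subset_iff l_minus a_inv_def[symmetric])
  fix a x assume a: "a \<in> annihilator R I" and x: "x \<in> carrier R"
  show "x \<otimes> a \<in> annihilator R I"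
    using a x I by (auto simp: annihilator_def m_assoc)
  then show "a \<otimes> x \<in> annihilator R I"
    using a x by (simp add: annihilator_def m_comm)
qed (rule ring_axioms)

lemma ideal_radical: "ideal (radical R I) R"
proof -
  have "ideal (\<Inter>(insert (carrier R) {P. primeideal P R \<and> I \<subseteq> P})) R"
    by (rule i_Intersect) (auto intro: oneideal primeideal.axioms(1))
  then show ?thesis
    by (simp add: radical_def)
qed

lemma annihilator_carrier: "annihilator R (carrier R) = {\<zero>}"
  by (auto simp: annihilator_def dest: bspec[OF _ one_closed])

lemma annihilator_zero: "annihilator R {\<zero>} = carrier R"
  by (auto simp: annihilator_def)

lemma annihilator_antimono: "I \<subseteq> J \<Longrightarrow> annihilator R J \<subseteq> annihilator R I"
  by (auto simp: annihilator_def)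

lemma annihilator_eq_carrier_iff:
  assumes "ideal I R"
  shows "annihilator R I = carrier R \<longleftrightarrow> I = {\<zero>}"
proof
  assume "annihilator R I = carrier R"
  then have "\<one> \<in> annihilator R I"
    by simp
  then have "I \<subseteq> {\<zero>}"
    using ideal.Icarr[OF assms] by (auto simp: annihilator_def)
  moreover have "\<zero> \<in> I"
    using assms by (simp add: additive_subgroup.zero_closed ideal.axioms(1))
  ultimately show "I = {\<zero>}"
    by blast
qed (simp add: annihilator_zero)

lemma subset_annihilator_annihilator:
  assumes "ideal I R"
  shows "I \<subseteq> annihilator R (annihilator R I)"
  using ideal.Icarr[OF assms] by (auto simp: annihilator_def m_comm)

text \<open>The usual fact for an antitone Galois connection: the inclusion into the double
  annihilator is applied to \<open>annihilator R I\<close>, and to \<open>I\<close> under one more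
  annihilator.\<close>

lemma annihilator3:
  assumes "ideal I R"
  shows "annihilator R (annihilator R (annihilator R I)) = annihilator R I"
  using assms by (intro equalityI annihilator_antimono subset_annihilator_annihilator ideal_annihilator)

section \<open>Words as maps on ideals, and a criterion for contractions\<close>

lemma ideal_ra_map: "ideal I R \<Longrightarrow> ideal (ra_map R g I) R"
  by (cases g) (simp_all add: ideals_def ideal_annihilator ideal_radical)

lemma ideal_foldr_ra_map: "ideal I R \<Longrightarrow> ideal (foldr (ra_map R) w I) R"
  by (induction w) (simp_all add: ideal_ra_map)

text \<open>Since \<open>foldr\<close> applies the last letter first, concatenation becomes
  composition. The restriction makes values off the ideals agree with those of
  \<open>compose (ideals R)\<close> and of the unit.\<close>

definition word_map :: "ra_gen list \<Rightarrow> 'a set \<Rightarrow> 'a set" where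
  "word_map w = (\<lambda>I \<in> ideals R. foldr (ra_map R) w I)"

lemma word_map_Nil: "word_map [] = (\<lambda>I \<in> ideals R. I)"
  by (simp add: word_map_def)

lemma word_map_single: "word_map [g] = ra_map R g"
  by (cases g) (auto simp: word_map_def fun_eq_iff)

lemma word_map_append: "word_map (u @ v) = compose (ideals R) (word_map u) (word_map v)"
  by (auto simp: word_map_def compose_def fun_eq_iff ideals_def ideal_foldr_ra_map)

lemma ra_maps_eq: "ra_maps R = range word_map"
proof
  show "ra_maps R \<subseteq> range word_map"
  proof
    fix f assume "f \<in> ra_maps R"
    then show "f \<in> range word_map"
    proof induction
      case one
      show ?case
        by (rule range_eqI[of _ _ "[]"]) (simp add: word_map_Nil)
    next
      case (gen g)
      show ?case
        by (rule range_eqI[of _ _ "[g]"]) (simp add: word_map_single)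
    next
      case (comp f g)
      then show ?case
        by (auto simp flip: word_map_append)
    qed
  qed
  have "word_map w \<in> ra_maps R" for w
  proof (induction w)
    case (Cons g w)
    then show ?case
      using word_map_append[of "[g]" w] by (simp add: word_map_single ra_maps.intros)
  next
    case Nil
    show ?case
      unfolding word_map_Nil by (rule ra_maps.one)
  qed
  then show "range word_map \<subseteq> ra_maps R"
    by blast
qed

lemma word_map_eq_iff:
  "word_map u = word_map v \<longleftrightarrow>
    (\<forall>I. ideal I R \<longrightarrow> foldr (ra_map R) u I = foldr (ra_map R) v I)"
  by (auto simp: word_map_def fun_eq_iff ideals_def restrict_def)

text \<open>This is the universal property of a presentation; the homomorphism is onto because, by
  \<open>ra_maps_eq\<close>, every element is the value of a word.\<close>

lemma ra_contraction_iff_word_map: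
  "ra_contraction R E \<longleftrightarrow> (\<forall>(u, v)\<in>E. word_map u = word_map v)"
proof
  assume "ra_contraction R E"
  then obtain h where h: "h \<in> hom (presented_monoid E) (ra_monoid R)"
    "h (word_class E []) = word_map []" "\<And>g. h (word_class E [g]) = ra_map R g"
    by (auto simp: ra_contraction_def contraction_def presented_monoid_def ra_monoid_def word_map_Nil)
  \<comment> \<open>A homomorphism is determined by its values on the generators, so
    \<open>h\<close> evaluates words.\<close>
  have "h (word_class E w) = word_map w" for w
  proof (induction w)
    case (Cons g w)
    have "h (word_class E (g # w)) = h (word_class E [g]) \<otimes>\<^bsub>ra_monoid R\<^esub> h (word_class E w)"
      using hom_mult[OF h(1), of "word_class E [g]" "word_class E w"]
      by (simp add: word_class_mult) (simp add: presented_monoid_def)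
    then show ?case
      using Cons word_map_append[of "[g]" w] by (simp add: h ra_monoid_def word_map_single)
  qed (simp add: h)
  then show "\<forall>(u, v)\<in>E. word_map u = word_map v"
    using word_class_eq_iff word_cong.rel by (metis (mono_tags, lifting) case_prodI2)
next
  assume rels: "\<forall>(u, v)\<in>E. word_map u = word_map v"
  have cong: "word_map u = word_map v" if "word_cong E u v" for u v
    using that by induction (use rels in \<open>auto simp: word_map_append\<close>)
  \<comment> \<open>Evaluation of words descends to classes: by \<open>cong\<close>, the choice of
    the representative does not matter.\<close>
  define h where "h A = word_map (SOME w. w \<in> A)" for A
  have h: "h (word_class E w) = word_map w" for w
  proof -
    have "word_cong E w (SOME v. v \<in> word_class E w)"
      using someI[of "\<lambda>v. v \<in> word_class E w" w] by (simp add: word_class_def word_cong.refl)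
    then show ?thesis
      using cong by (simp add: h_def)
  qed
  have "h \<in> hom (presented_monoid E) (ra_monoid R)"
  proof (rule homI)
    fix A assume "A \<in> carrier (presented_monoid E)"
    then obtain u where u: "A = word_class E u"
      by (auto simp: presented_monoid_def)
    show "h A \<in> carrier (ra_monoid R)"
      by (simp add: u h ra_monoid_def ra_maps_eq)
    fix B assume "B \<in> carrier (presented_monoid E)"
    then obtain v where v: "B = word_class E v"
      by (auto simp: presented_monoid_def)
    show "h (A \<otimes>\<^bsub>presented_monoid E\<^esub> B) = h A \<otimes>\<^bsub>ra_monoid R\<^esub> h B"
      by (simp add: u v word_class_mult h word_map_append ra_monoid_def)
  qed
  moreover have "h ` carrier (presented_monoid E) = carrier (ra_monoid R)"
    by (simp add: presented_monoid_def ra_monoid_def ra_maps_eq image_image h)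
  moreover have "h \<one>\<^bsub>presented_monoid E\<^esub> = \<one>\<^bsub>ra_monoid R\<^esub>"
    by (simp add: presented_monoid_def ra_monoid_def h word_map_Nil)
  moreover have "h (word_class E [g]) = ra_map R g" for g
    by (simp add: h word_map_single)
  ultimately show "ra_contraction R E"
    unfolding ra_contraction_def contraction_def by blast
qed

lemma ra_contraction_iff:
  "ra_contraction R E \<longleftrightarrow>
    (\<forall>I. ideal I R \<longrightarrow> (\<forall>(u, v)\<in>E. foldr (ra_map R) u I = foldr (ra_map R) v I))"
  unfolding ra_contraction_iff_word_map word_map_eq_iff case_prod_unfold by blast

lemma ideal_k_number_le:
  assumes "ideal I R" "I \<in> T" "finite T" and closed: "\<And>J g. J \<in> T \<Longrightarrow> ra_map R g J \<in> T"
  shows "ideal_k_number R I \<le> card T"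
proof -
  have "foldr (ra_map R) w I \<in> T" for w
    by (induction w) (use assms in auto)
  then have sub: "{w I |w. w \<in> carrier (ra_monoid R)} \<subseteq> T"
    using assms(1) by (auto simp: ra_monoid_def ra_maps_eq word_map_def ideals_def)
  then show ?thesis
    using assms(3) by (simp add: ideal_k_number_def ecard_def finite_subset card_mono)
qed

lemma exists_maximalideal:
  assumes "ideal I R" "I \<noteq> carrier R"
  obtains M where "maximalideal M R" "I \<subseteq> M"
proof -
  \<comment> \<open>Properness is encoded as \<open>\<one> \<notin> J\<close>, a condition that
    passes to unions of chains.\<close>
  define S where "S = {J. ideal J R \<and> \<one> \<notin> J \<and> I \<subseteq> J}"
  have "\<exists>M\<in>S. \<forall>J\<in>S. M \<subseteq> J \<longrightarrow> J = M"
  proof (rule subset_Zorn_nonempty)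
    have "I \<in> S"
      using assms ideal.one_imp_carrier by (auto simp: S_def)
    then show "S \<noteq> {}"
      by blast
    fix C assume C: "C \<noteq> {}" "subset.chain S C"
    then have sub: "C \<subseteq> S"
      by (simp add: pred_on.chain_def)
    have "subset.chain {J. ideal J R} C"
      using C(2) by (auto simp: S_def pred_on.chain_def)
    then have "ideal (\<Union>C) R"
      using chain_Union_is_ideal[of C] C(1) by simp
    moreover have "\<one> \<notin> \<Union>C" "I \<subseteq> \<Union>C"
      using sub C(1) by (auto simp: S_def)
    ultimately show "\<Union>C \<in> S"
      by (simp add: S_def)
  qed
  then obtain M where "M \<in> S" and "\<forall>J\<in>S. M \<subseteq> J \<longrightarrow> J = M"
    by blast
  then have M: "ideal M R" "\<one> \<notin> M" "I \<subseteq> M"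
    and max: "\<And>J. ideal J R \<Longrightarrow> \<one> \<notin> J \<Longrightarrow> M \<subseteq> J \<Longrightarrow> J = M"
    by (auto simp: S_def)
  have "maximalideal M R"
  proof (rule maximalidealI)
    show "carrier R \<noteq> M"
      using M(2) one_closed by blast
    show "J = M \<or> J = carrier R" if "ideal J R" "M \<subseteq> J" for J
      using max[OF that(1) _ that(2)] ideal.one_imp_carrier[OF that(1)] by (cases "\<one> \<in> J") simp_all
  qed (rule M(1))
  then show thesis
    using that M(3) by blast
qed

end

section \<open>Rings with a single prime ideal\<close>

text \<open>Strictly nested primes form a chain of length 1, which pushes the supremum to at least
  1.\<close>

lemma krull_dim_0_not_psubset:
  assumes "krull_dim R = 0" "primeideal P R" "primeideal Q R"
  shows "\<not> P \<subset> Q"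
proof
  assume "P \<subset> Q"
  then have "\<exists>F. (\<forall>i\<le>1. primeideal (F i) R) \<and> (\<forall>i<1. F i \<subset> F (Suc i))"
    using assms(2,3) by (intro exI[of _ "\<lambda>i :: nat. if i = 0 then P else Q"]) auto
  then have "enat 1 \<le> krull_dim R"
    unfolding krull_dim_def by (intro Sup_upper) blast
  then show False
    using assms(1) by (simp add: zero_enat_def)
qed

locale single_prime_ring = cring +
  fixes M
  assumes primeideal_iff: "primeideal P R \<longleftrightarrow> P = M"
    and proper_subset: "ideal I R \<Longrightarrow> I \<noteq> carrier R \<Longrightarrow> I \<subseteq> M"

lemma (in cring) single_prime_ringI:
  assumes "local_ring R" "krull_dim R = 0"
  obtains M where "single_prime_ring R M"
proof -
  obtain M where M: "maximalideal M R" and unique: "\<And>N. maximalideal N R \<Longrightarrow> N = M"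
    using assms(1) unfolding local_ring_def by blast
  have sub: "I \<subseteq> M" if "ideal I R" "I \<noteq> carrier R" for I
    using exists_maximalideal[OF that] unique by metis
  have prime: "primeideal M R"
    by (rule maximalideal_prime[OF M])
  \<comment> \<open>A prime is proper, hence inside \<open>M\<close>, and a strict inclusion of
    primes would contradict dimension zero.\<close>
  have "P = M" if "primeideal P R" for P
    using sub[of P] that krull_dim_0_not_psubset[OF assms(2) that prime]
    by (metis primeideal.axioms(1) primeideal.I_notcarr psubsetI)
  with prime sub have "single_prime_ring R M"
    by unfold_locales blast+
  then show thesis
    using that by blast
qed

context single_prime_ring
begin

lemma primeideal_M: "primeideal M R"
  by (simp add: primeideal_iff)

lemma ideal_M: "ideal M R"
  using primeideal_M by (rule primeideal.axioms)

lemma M_proper: "M \<noteq> carrier R"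
  using primeideal.I_notcarr[OF primeideal_M] by simp

lemma M_maximal: "maximalideal M R"
proof (rule maximalidealI[OF ideal_M])
  show "J = M \<or> J = carrier R" if "ideal J R" "M \<subseteq> J" for J
    using proper_subset[OF that(1)] that(2) by blast
qed (use M_proper in simp)

lemma radical_eq:
  assumes "ideal I R"
  shows "radical R I = (if I = carrier R then carrier R else M)"
proof -
  have sub: "M \<subseteq> carrier R"
    using ideal.Icarr[OF ideal_M] by blast
  then have "carrier R \<subseteq> M \<longleftrightarrow> False"
    using M_proper by blast
  then have "{P. primeideal P R \<and> I \<subseteq> P} = (if I = carrier R then {} else {M})"
    using assms proper_subset by (auto simp: primeideal_iff)
  then show ?thesis
    using sub by (auto simp: radical_def)
qed

lemma zero_proper: "{\<zero>} \<noteq> carrier R"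
  using M_proper ideal_M by (metis ideal.axioms(1) additive_subgroup.a_subset
      additive_subgroup.zero_closed empty_iff insert_subset subset_singletonD equalityI)

lemma field_iff: "field R \<longleftrightarrow> M = {\<zero>}"
proof
  assume "field R"
  then have "maximalideal {\<zero>} R"
    by (rule field.zeromaximalideal)
  then show "M = {\<zero>}"
    using maximalideal_prime[of "{\<zero>}"] by (simp add: primeideal_iff)
qed (use M_maximal zeromaximalideal_eq_field in simp)

text \<open>These rules evaluate words at an ideal: \<open>radical_eq\<close> branches on whether
  its argument is the whole ring, and \<open>annihilator_eq_carrier_iff\<close> settles this test
  for annihilators.\<close>

lemmas eval = ideals_def radical_eq ideal_annihilator ideal_M
  oneideal zeroideal annihilator_carrier annihilator_zero annihilator3 annihilator_eq_carrier_iff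
  M_proper zero_proper basic_rels_def

section \<open>Which relations hold in the ring\<close>

lemma annihilator_M_subset:
  assumes "ideal I R" "I \<noteq> carrier R"
  shows "annihilator R M \<subseteq> annihilator R I"
  using assms by (intro annihilator_antimono proper_subset)

text \<open>The double annihilator contains the maximal ideal \<open>M\<close>, and it is proper
  because only the zero ideal is annihilated by all of \<open>R\<close>.\<close>

lemma annihilator2_M:
  assumes "annihilator R M \<noteq> {\<zero>}"
  shows "annihilator R (annihilator R M) = M"
proof
  have "annihilator R (annihilator R M) \<noteq> carrier R"
    using assms ideal_M by (simp add: ideal_annihilator annihilator_eq_carrier_iff)
  then show "annihilator R (annihilator R M) \<subseteq> M"
    using ideal_M by (intro proper_subset ideal_annihilator)
qed (rule subset_annihilator_annihilator[OF ideal_M])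

text \<open>The only ideals are 0 and \<open>R\<close>; the radical fixes both and the annihilator
  swaps them.\<close>

lemma ra_contraction_a:
  assumes "M = {\<zero>}"
  shows "ra_contraction R rels_a"
proof -
  have "\<forall>(u, v)\<in>rels_a. foldr (ra_map R) u I = foldr (ra_map R) v I" if I: "ideal I R" for I
  proof -
    have "I = {\<zero>} \<or> I = carrier R"
      using proper_subset[OF I] assms additive_subgroup.zero_closed[OF ideal.axioms(1)[OF I]]
      by blast
    then show ?thesis
      by (elim disjE) (simp_all add: eval assms rels_a_def)
  qed
  then show ?thesis
    by (simp add: ra_contraction_iff)
qed

lemma ra_contraction_b_iff:
  "ra_contraction R rels_b \<longleftrightarrow> M \<noteq> {\<zero>} \<and> annihilator R M \<noteq> {\<zero>}"
proof
  assume "ra_contraction R rels_b"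
  then have rels: "foldr (ra_map R) u I = foldr (ra_map R) v I"
    if "(u, v) \<in> rels_b" "ideal I R" for u v I
    using that unfolding ra_contraction_iff by blast
  \<comment> \<open>At \<open>R\<close>, the relation \<open>rar = rara\<close> reads
    \<open>M = r(a(M))\<close>; for \<open>M = 0\<close> the right side would be
    \<open>R\<close>.\<close>
  have "M \<noteq> {\<zero>}"
    using rels[of "[Rad, Ann, Rad]" "[Rad, Ann, Rad, Ann]" "carrier R"]
    by (auto simp: rels_b_def eval)
  \<comment> \<open>At \<open>M\<close>, the relation \<open>r = a^2r\<close> reads
    \<open>M = a(a(M))\<close>; for \<open>a(M) = 0\<close> the right side would be
    \<open>R\<close>.\<close>
  moreover have "annihilator R M \<noteq> {\<zero>}"
    using rels[of "[Rad]" "[Ann, Ann, Rad]" M] M_proper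
    by (auto simp: rels_b_def eval)
  ultimately show "M \<noteq> {\<zero>} \<and> annihilator R M \<noteq> {\<zero>}" ..
next
  assume *: "M \<noteq> {\<zero>} \<and> annihilator R M \<noteq> {\<zero>}"
  \<comment> \<open>Hence \<open>a^2\<close> keeps proper ideals proper, so \<open>r\<close>,
    \<open>a^2r\<close> and \<open>ra^2\<close> all send them to \<open>M\<close>, while
    \<open>rar\<close> and \<open>rara\<close> send every ideal to \<open>M\<close>.\<close>
  have "annihilator R I \<noteq> {\<zero>}" if "ideal I R" "I \<noteq> carrier R" for I
    using annihilator_M_subset[OF that] * additive_subgroup.zero_closed[OF ideal.axioms(1)]
      ideal_annihilator[OF ideal_M] by blast
  then have "\<forall>(u, v)\<in>rels_b. foldr (ra_map R) u I = foldr (ra_map R) v I" if "ideal I R" for I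
    using * that by (cases "I = carrier R") (auto simp: eval zero_proper[symmetric] rels_b_def annihilator2_M)
  then show "ra_contraction R rels_b"
    by (simp add: ra_contraction_iff)
qed

text \<open>At \<open>R\<close>, the relation \<open>ar = ara\<close> reads \<open>0 = a(M)\<close>.
  Conversely, a radical is \<open>M\<close> or \<open>R\<close>; if both have annihilator 0, then
  \<open>ar\<close> and \<open>ara\<close> are constantly 0, and \<open>a^2r\<close> and
  \<open>ra^2r\<close> constantly \<open>R\<close>.\<close>

lemma ra_contraction_c_iff: "ra_contraction R rels_c \<longleftrightarrow> annihilator R M = {\<zero>}"
proof
  assume "ra_contraction R rels_c"
  then have "foldr (ra_map R) [Ann, Rad] (carrier R) = foldr (ra_map R) [Ann, Rad, Ann] (carrier R)"
    using oneideal unfolding ra_contraction_iff rels_c_def by blast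
  then show "annihilator R M = {\<zero>}"
    by (simp add: eval)
next
  assume "annihilator R M = {\<zero>}"
  then have "\<forall>(u, v)\<in>rels_c. foldr (ra_map R) u I = foldr (ra_map R) v I" if "ideal I R" for I
    using that by (simp add: eval rels_c_def)
  then show "ra_contraction R rels_c"
    by (simp add: ra_contraction_iff)
qed

section \<open>Bounds on the k-number\<close>

lemma ring_k_number_b:
  assumes "M \<noteq> {\<zero>}" "annihilator R M \<noteq> {\<zero>}"
  shows "ring_k_number R \<le> 5"
proof -
  \<comment> \<open>The annihilator swaps 0 and \<open>R\<close>, so their orbits contain both; the
    orbits of all other ideals avoid them.\<close>
  have "ideal_k_number R I \<le> 5" if I: "ideal I R" for I
  proof (cases "I = {\<zero>} \<or> I = carrier R")
    case True
    let ?T = "{{\<zero>}, carrier R, M, annihilator R M}"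
    have closed: "ra_map R g J \<in> ?T" if "J \<in> ?T" for g J
      using that assms by (elim insertE emptyE; cases g) (simp_all add: eval annihilator2_M)
    have "ideal_k_number R I \<le> card ?T"
      by (rule ideal_k_number_le) (use I True closed in auto)
    also have "\<dots> \<le> 5"
      using card_length[of "[{\<zero>}, carrier R, M, annihilator R M]"] by (simp add: numeral_eq_enat)
    finally show ?thesis .
  next
    case False
    let ?A = "annihilator R I"
    let ?T = "{I, ?A, annihilator R ?A, M, annihilator R M}"
    \<comment> \<open>This keeps the double annihilator of \<open>I\<close> proper, so that its
      radical is \<open>M\<close>.\<close>
    have "?A \<noteq> {\<zero>}"
      using annihilator_M_subset[OF I] False assms additive_subgroup.zero_closed[OF ideal.axioms(1)]
        ideal_annihilator[OF ideal_M] by blast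
    then have closed: "ra_map R g J \<in> ?T" if "J \<in> ?T" for g J
      using that I False assms by (elim insertE emptyE; cases g) (simp_all add: eval annihilator2_M)
    have "ideal_k_number R I \<le> card ?T"
      by (rule ideal_k_number_le) (use I closed in simp_all)
    also have "\<dots> \<le> 5"
      using card_length[of "[I, ?A, annihilator R ?A, M, annihilator R M]"]
      by (simp add: numeral_eq_enat)
    finally show ?thesis .
  qed
  then show ?thesis
    by (simp add: ring_k_number_def ideals_def SUP_le_iff)
qed

lemma ring_k_number_c:
  assumes "annihilator R M = {\<zero>}"
  shows "ring_k_number R \<le> 6"
proof -
  have "ideal_k_number R I \<le> 6" if I: "ideal I R" for I
  proof -
    let ?A = "annihilator R I"
    \<comment> \<open>Radicals are \<open>M\<close> or \<open>R\<close>, both have annihilator 0,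
      and the annihilator of 0 is \<open>R\<close>; beyond these three ideals only \<open>I\<close>
      and its iterated annihilators occur.\<close>
    let ?T = "{I, ?A, annihilator R ?A, {\<zero>}, carrier R, M}"
    have closed: "ra_map R g J \<in> ?T" if "J \<in> ?T" for g J
      using that I assms by (elim insertE emptyE; cases g) (simp_all add: eval)
    have "ideal_k_number R I \<le> card ?T"
      by (rule ideal_k_number_le) (use I closed in simp_all)
    also have "\<dots> \<le> 6"
      using card_length[of "[I, ?A, annihilator R ?A, {\<zero>}, carrier R, M]"]
      by (simp add: numeral_eq_enat)
    finally show ?thesis .
  qed
  then show ?thesis
    by (simp add: ring_k_number_def ideals_def SUP_le_iff)
qed

end

theorem theorem4p18:
  fixes R :: "('a, 'm) ring_scheme"
  assumes "cring R" and "local_ring R" and "krull_dim R = 0"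
  shows "((field R \<and> ra_contraction R rels_a) \<or> ra_contraction R rels_b \<or> ra_contraction R rels_c) \<and>
         (ra_contraction R rels_b \<longrightarrow> ring_k_number R \<le> 5) \<and>
         (ra_contraction R rels_c \<longrightarrow> ring_k_number R \<le> 6) \<and>
         K_number (presented_monoid rels_a) = 2 \<and>
         K_number (presented_monoid rels_b) = 9 \<and>
         K_number (presented_monoid rels_c) = 9"
proof -
  obtain M where "single_prime_ring R M"
    using cring.single_prime_ringI[OF assms] by blast
  then interpret single_prime_ring R M .
  show ?thesis
    \<comment> \<open>The types correspond to \<open>M = 0\<close>, neither \<open>M\<close> nor
      \<open>a(M)\<close> zero, and \<open>a(M) = 0\<close>. The two equivalences turn the premises
      of the k-number bounds into these conditions.\<close>
    using field_iff ra_contraction_a ra_contraction_b_iff ra_contraction_c_iff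
      ring_k_number_b ring_k_number_c K_number_a K_number_b K_number_c by blast
qed

end
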